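(* Let $(X_n)_{n\in\mathbb N_0}$ be a Cartesian system over $\mathbb N_0$ with injections $i_{m,n}\colon X_{m+n}\to X_m\times X_n$, and fix $k\in\mathbb N=\{1,2,\dots\}$. Define $Y_n:=X_{n+k}$ for $n>0$ and $Y_0:=\{\Lambda\}$ (a one-point set). For $m,n\ge 1$ define $j_{m,n}\colon Y_{m+n}=X_{m+n+k}\to X_{m+k}\times X_{n+k}=Y_m\times Y_n$ by $$j_{m,n}(x):=\bigl(P_1(i_{m+k,n}(x)),\,P_2(i_{m,k+n}(x))\bigr),$$ where $P_1,P_2$ denote the projections of a product of two sets onto its first and second factor, and let $j_{m,0}\colon Y_m\to Y_m\times Y_0$, $x\mapsto (x,\Lambda)$, and $j_{0,n}\colon Y_n\to Y_0\times Y_n$, $x\mapsto(\Lambda,x)$, be the canonical injections. Then the maps $j_{m,n}$ are injective, and $(Y_n)_{n\in\mathbb N_0}$ together with the $j_{m,n}$ is a Cartesian system over $\mathbb N_0$.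
   Context: A Cartesian system over $\mathbb N_0$ is a family $(X_n)_{n\in\mathbb N_0}$ of sets with $X_0=\{\Lambda\}$ a one-point set, together with injections $i_{m,n}\colon X_{m+n}\to X_m\times X_n$ ($m,n\in\mathbb N_0$) such that, for all $\ell,m,n\in\mathbb N_0$, $$(i_{\ell,m}\times \mathrm{id}_{X_n})\circ i_{\ell+m,n}=(\mathrm{id}_{X_\ell}\times i_{m,n})\circ i_{\ell,m+n}$$ as maps $X_{\ell+m+n}\to X_\ell\times X_m\times X_n$, and such that $i_{0,n}(x)=(\Lambda,x)$ and $i_{n,0}(x)=(x,\Lambda)$ for all $x\in X_n$. *)

theory Defs
  imports Main "HOL-Library.FuncSet"
begin

text \<open>The family \<open>X\<close> takes its values in the subsets of one ambient type; the sets
  \<open>X n\<close> need not be disjoint. Only the values of \<open>i m n\<close> on \<open>X (m + n)\<close> matter.\<close>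

definition prod_assoc :: "('a \<times> 'b) \<times> 'c \<Rightarrow> 'a \<times> 'b \<times> 'c" where
  "prod_assoc = (\<lambda>((a, b), c). (a, b, c))"

locale cartesian_system =
  fixes X :: "nat \<Rightarrow> 'a set"
    and pt :: 'a
    and i :: "nat \<Rightarrow> nat \<Rightarrow> 'a \<Rightarrow> 'a \<times> 'a"
  assumes X_0: "X 0 = {pt}"
    and maps_to: "i m n \<in> X (m + n) \<rightarrow> X m \<times> X n"
    and inj: "inj_on (i m n) (X (m + n))"
    and coassoc: "x \<in> X (l + m + n) \<Longrightarrow>
      prod_assoc (map_prod (i l m) id (i (l + m) n x)) = map_prod id (i m n) (i l (m + n) x)"
    and left_unit: "x \<in> X n \<Longrightarrow> i 0 n x = (pt, x)"
    and right_unit: "x \<in> X n \<Longrightarrow> i n 0 x = (x, pt)"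

definition shift_sets :: "(nat \<Rightarrow> 'a set) \<Rightarrow> 'a \<Rightarrow> nat \<Rightarrow> nat \<Rightarrow> 'a set" where
  "shift_sets X pt k n = (if n = 0 then {pt} else X (n + k))"

text \<open>For \<open>m = n = 0\<close> the two unit clauses agree on \<open>{pt}\<close>.\<close>

definition shift_maps ::
  "(nat \<Rightarrow> nat \<Rightarrow> 'a \<Rightarrow> 'a \<times> 'a) \<Rightarrow> 'a \<Rightarrow> nat \<Rightarrow> nat \<Rightarrow> nat \<Rightarrow> 'a \<Rightarrow> 'a \<times> 'a" where
  "shift_maps i pt k m n x =
    (if m = 0 then (pt, x)
     else if n = 0 then (x, pt)
     else (fst (i (m + k) n x), snd (i m (k + n) x)))"

end

theory Submission
  imports Defs
begin

text \<open>Elements of \<open>X n\<close> behave like words of length \<open>n\<close>: \<open>j m n\<close> sends a word of length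
  \<open>m + k + n\<close> to its prefix of length \<open>m + k\<close> and its suffix of length \<open>k + n\<close>. These overlap,
  and the suffix of length \<open>n\<close> can be read off the longer suffix, so injectivity of
  \<open>i (m + k) n\<close> applies. Coassociativity of \<open>j\<close> reduces to its three components, which say that
  a prefix of a prefix is a prefix, that the middle factor does not depend on the order of
  cutting, and that a suffix of a suffix is a suffix.\<close>

context cartesian_system
begin

lemma fst_in: "x \<in> X (m + n) \<Longrightarrow> fst (i m n x) \<in> X m"
  using maps_to[of m n] by (auto simp: Pi_iff mem_Times_iff)

lemma snd_in: "x \<in> X (m + n) \<Longrightarrow> snd (i m n x) \<in> X n"
  using maps_to[of m n] by (auto simp: Pi_iff mem_Times_iff)

text \<open>The three components of \<open>coassoc\<close>, stated separately because
  coassociativity of the shifted maps needs each at a different splitting of the index.\<close>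

lemma
  assumes "x \<in> X (l + m + n)"
  shows prefix_prefix: "fst (i l m (fst (i (l + m) n x))) = fst (i l (m + n) x)"
    and suffix_prefix: "snd (i l m (fst (i (l + m) n x))) = fst (i m n (snd (i l (m + n) x)))"
    and suffix_suffix: "snd (i m n (snd (i l (m + n) x))) = snd (i (l + m) n x)"
  using coassoc[OF assms]
  by (simp_all add: prod_assoc_def map_prod_def case_prod_beta prod_eq_iff)

lemma inj_on_overlapping_split:
  "inj_on (\<lambda>x. (fst (i (m + k) n x), snd (i m (k + n) x))) (X (m + k + n))"
proof (rule inj_onI)
  fix x y
  assume x: "x \<in> X (m + k + n)" and y: "y \<in> X (m + k + n)"
    and eq: "(fst (i (m + k) n x), snd (i m (k + n) x)) =
      (fst (i (m + k) n y), snd (i m (k + n) y))"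
  from eq have "snd (i (m + k) n x) = snd (i (m + k) n y)"
    using suffix_suffix[OF x] suffix_suffix[OF y] by simp
  with eq have "i (m + k) n x = i (m + k) n y"
    by (simp add: prod_eq_iff)
  with inj x y show "x = y"
    by (auto dest: inj_onD)
qed

lemma inj_on_shift_maps: "inj_on (shift_maps i pt k m n) (shift_sets X pt k (m + n))"
proof (cases "m = 0 \<or> n = 0")
  case True
  \<comment> \<open>If an index is 0, the pair contains \<open>x\<close> itself.\<close>
  then show ?thesis
    by (auto simp: shift_maps_def inj_on_def)
next
  case False
  then show ?thesis
    using inj_on_overlapping_split[of m k n]
    by (simp add: shift_maps_def shift_sets_def inj_on_def ac_simps)
qed

lemma shift_maps_in:
  "shift_maps i pt k m n \<in> shift_sets X pt k (m + n) \<rightarrow> shift_sets X pt k m \<times> shift_sets X pt k n"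
proof
  fix x
  assume x: "x \<in> shift_sets X pt k (m + n)"
  show "shift_maps i pt k m n x \<in> shift_sets X pt k m \<times> shift_sets X pt k n"
  proof (cases "m = 0 \<or> n = 0")
    case True
    with x show ?thesis
      by (auto simp: shift_maps_def shift_sets_def)
  next
    case False
    with x show ?thesis
      using fst_in[of x "m + k" n] snd_in[of x m "k + n"]
      by (simp add: shift_maps_def shift_sets_def ac_simps)
  qed
qed

lemma shift_maps_coassoc:
  assumes x: "x \<in> shift_sets X pt k (l + m + n)"
  shows "prod_assoc (map_prod (shift_maps i pt k l m) id (shift_maps i pt k (l + m) n x)) =
    map_prod id (shift_maps i pt k m n) (shift_maps i pt k l (m + n) x)"
proof (cases "l = 0 \<or> m = 0 \<or> n = 0")
  case True
  with x show ?thesis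
    by (auto simp: shift_maps_def shift_sets_def prod_assoc_def)
next
  case False
  \<comment> \<open>The extra length \<open>k\<close> is attached to the block that the respective
    component keeps: first, middle or last.\<close>
  with x have "x \<in> X (l + k + m + n)" "x \<in> X (l + (k + m) + n)" "x \<in> X (l + m + (k + n))"
    by (simp_all add: shift_sets_def ac_simps)
  from prefix_prefix[OF this(1)] suffix_prefix[OF this(2)] suffix_suffix[OF this(3)] False
  show ?thesis
    by (simp add: shift_maps_def prod_assoc_def ac_simps)
qed

lemma cartesian_system_shift: "cartesian_system (shift_sets X pt k) pt (shift_maps i pt k)"
  \<comment> \<open>At indices 0, 0 the map gives \<open>(pt, x)\<close>, so the right unit law
    there uses \<open>x = pt\<close>, which holds since the zeroth set is
    \<open>{pt}\<close>.\<close>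
  by unfold_locales
    (simp_all add: shift_maps_in inj_on_shift_maps shift_maps_coassoc,
      auto simp: shift_sets_def shift_maps_def split: if_splits)

end

theorem theorem5p3:
  fixes X :: "nat \<Rightarrow> 'a set"
    and pt :: 'a
    and i :: "nat \<Rightarrow> nat \<Rightarrow> 'a \<Rightarrow> 'a \<times> 'a"
    and k :: nat
  assumes "cartesian_system X pt i"
    and "k \<ge> 1"
  shows "(\<forall>m n. inj_on (shift_maps i pt k m n) (shift_sets X pt k (m + n))) \<and>
    cartesian_system (shift_sets X pt k) pt (shift_maps i pt k)"
  using cartesian_system.inj_on_shift_maps[OF assms(1)]
    cartesian_system.cartesian_system_shift[OF assms(1)]
  by blast

end
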